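(* Let $\star$ be a semistar operation on an integral domain $D$. Let $I$ be a nonzero fractional ideal of $D$ which is quasi-$\star$-invertible. Then $I$ is $\star$-invertible if and only if $(D:I)^\star=(D^\star:I)$.
   Context: Let $D$ be an integral domain with quotient field $K$; $\overline{F}(D)$ is the set of nonzero $D$-submodules of $K$. A semistar operation on $D$ is a map $\star:\overline{F}(D)\to\overline{F}(D)$, $E\mapsto E^\star$, such that for all $0\ne x\in K$ and $E,F\in\overline{F}(D)$: $(xE)^\star=xE^\star$; $E\subseteq F$ implies $E^\star\subseteq F^\star$; $E\subseteq E^\star$ and $(E^\star)^\star=E^\star$. For $E,F\in\overline{F}(D)$, $(E:F)=\{z\in K: zF\subseteq E\}$, and $I^{-1}=(D:I)$. A nonzero fractional ideal $I$ of $D$ is $\star$-invertible if $(II^{-1})^\star=D^\star$. An element $I\in\overline{F}(D)$ is quasi-$\star$-invertible if $(I(D^\star:I))^\star=D^\star$. *)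

theory Defs
  imports "HOL-Library.FuncSet" "HOL-Computational_Algebra.Polynomial_Factorial"
begin

text \<open>The integral domain \<open>D\<close> is a type \<open>'a\<close> of class \<open>idom\<close> and its quotient field \<open>K\<close> is
  \<open>'a fract\<close>. As a subset of \<open>K\<close>, the domain \<open>D\<close> is the range of the embedding
  \<open>to_fract\<close>.\<close>

abbreviation base_dom :: "'a::idom fract set" where
  "base_dom \<equiv> range to_fract"

global_interpretation fract_module: module "\<lambda>(d::'a::idom) (x::'a fract). to_fract d * x"
  defines dsubmodule = fract_module.subspace
    and dspan = fract_module.span
  by unfold_locales (simp_all add: algebra_simps)

definition Fbar :: "'a::idom fract set set" where
  "Fbar = {E. dsubmodule E \<and> E \<noteq> {0}}"

definition fractional_ideal :: "'a::idom fract set \<Rightarrow> bool" where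
  "fractional_ideal I \<longleftrightarrow>
     dsubmodule I \<and> (\<exists>d::'a. d \<noteq> 0 \<and> (\<forall>x\<in>I. to_fract d * x \<in> base_dom))"

definition mod_prod :: "'a::idom fract set \<Rightarrow> 'a fract set \<Rightarrow> 'a fract set" where
  "mod_prod E F = dspan {x * y | x y. x \<in> E \<and> y \<in> F}"

definition mod_colon :: "'a::idom fract set \<Rightarrow> 'a fract set \<Rightarrow> 'a fract set" where
  "mod_colon E F = {z. (\<lambda>y. z * y) ` F \<subseteq> E}"

text \<open>HOL functions are total: the values of \<open>star\<close> outside \<open>Fbar\<close> are unconstrained.\<close>

definition semistar_operation :: "('a::idom fract set \<Rightarrow> 'a fract set) \<Rightarrow> bool" where
  "semistar_operation star \<longleftrightarrow>
     star \<in> Fbar \<rightarrow> Fbar \<and>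
     (\<forall>x E. x \<noteq> 0 \<longrightarrow> E \<in> Fbar \<longrightarrow> star ((\<lambda>y. x * y) ` E) = (\<lambda>y. x * y) ` star E) \<and>
     (\<forall>E\<in>Fbar. \<forall>F\<in>Fbar. E \<subseteq> F \<longrightarrow> star E \<subseteq> star F) \<and>
     (\<forall>E\<in>Fbar. E \<subseteq> star E \<and> star (star E) = star E)"

definition star_invertible ::
    "('a::idom fract set \<Rightarrow> 'a fract set) \<Rightarrow> 'a fract set \<Rightarrow> bool" where
  "star_invertible star I \<longleftrightarrow>
     fractional_ideal I \<and> I \<noteq> {0} \<and> star (mod_prod I (mod_colon base_dom I)) = star base_dom"

text \<open>For a general \<open>I\<close> in \<open>Fbar\<close> the module \<open>(D\<^sup>\<star> : I)\<close>, and hence its product with \<open>I\<close>, can be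
  zero, and then \<open>star\<close> is not defined on the product. The membership condition excludes that
  case; it holds automatically when \<open>I\<close> is a nonzero fractional ideal.\<close>

definition quasi_star_invertible ::
    "('a::idom fract set \<Rightarrow> 'a fract set) \<Rightarrow> 'a fract set \<Rightarrow> bool" where
  "quasi_star_invertible star I \<longleftrightarrow>
     I \<in> Fbar \<and> mod_prod I (mod_colon (star base_dom) I) \<in> Fbar \<and>
     star (mod_prod I (mod_colon (star base_dom) I)) = star base_dom"

end

theory Submission
  imports Defs
begin

text \<open>
  Write \<open>A = (D : I)\<close> and \<open>B = (D\<^sup>\<star> : I)\<close>, so that \<open>A \<subseteq> B\<close>. Everything rests on one property of a
  semistar operation, \<open>semistar_mult_closed\<close>: if multiplication by \<open>x\<close> maps \<open>E\<close> into a closed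
  module \<open>F\<^sup>\<star>\<close>, then it maps the whole closure \<open>E\<^sup>\<star>\<close> into \<open>F\<^sup>\<star>\<close>. The inclusion \<open>A\<^sup>\<star> \<subseteq> B\<close> always
  holds, because every \<open>y \<in> I\<close> multiplies \<open>A\<close> into \<open>D \<subseteq> D\<^sup>\<star>\<close>.

  Suppose that \<open>(I A)\<^sup>\<star> = D\<^sup>\<star>\<close>, and let \<open>z \<in> B\<close>. Then \<open>z I \<subseteq> D\<^sup>\<star>\<close> and \<open>A D\<^sup>\<star> \<subseteq> A\<^sup>\<star>\<close>, so \<open>z\<close> multiplies
  \<open>I A\<close> into \<open>A\<^sup>\<star>\<close>, and hence also its closure \<open>D\<^sup>\<star>\<close>. As \<open>1 \<in> D\<^sup>\<star>\<close>, this gives \<open>z \<in> A\<^sup>\<star>\<close>.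

  Suppose conversely that \<open>A\<^sup>\<star> = B\<close>. Closing a factor does not change the closure of a product, so
  \<open>(I A)\<^sup>\<star> = (I A\<^sup>\<star>)\<^sup>\<star> = (I B)\<^sup>\<star>\<close>, and this is \<open>D\<^sup>\<star>\<close> by quasi-\<open>\<star>\<close>-invertibility.
\<close>

text \<open>To show that \<open>x\<close> multiplies a product of modules into \<open>E\<close>, it therefore suffices to check
  the products of elements that span it.\<close>

lemma dsubmodule_mult_preimage:
  assumes "dsubmodule E"
  shows "dsubmodule {y. x * y \<in> E}"
proof -
  have "x * (to_fract d * y) \<in> E" if "x * y \<in> E" for d y
    using fract_module.subspace_scale[OF assms that, of d] by (simp add: mult.left_commute)
  then show ?thesis
    using fract_module.subspace_0[OF assms] fract_module.subspace_add[OF assms]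
    unfolding fract_module.subspace_def by (auto simp: distrib_left)
qed

lemma dsubmodule_mult_image:
  assumes "dsubmodule E"
  shows "dsubmodule ((\<lambda>y. x * y) ` E)"
proof -
  have "to_fract d * (x * y) \<in> (\<lambda>y. x * y) ` E" if "y \<in> E" for d y
    using fract_module.subspace_scale[OF assms that, of d]
    by (metis imageI mult.left_commute)
  moreover have "x * y + x * z \<in> (\<lambda>y. x * y) ` E" if "y \<in> E" "z \<in> E" for y z
    using fract_module.subspace_add[OF assms that] by (metis imageI distrib_left)
  moreover have "0 \<in> (\<lambda>y. x * y) ` E"
    using fract_module.subspace_0[OF assms] by (metis imageI mult_zero_right)
  ultimately show ?thesis
    unfolding fract_module.subspace_def by auto
qed

lemma dsubmodule_base_dom: "dsubmodule (base_dom :: 'a::idom fract set)"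
proof -
  have "0 \<in> (base_dom :: 'a fract set)"
    by (metis rangeI to_fract_0)
  moreover have "to_fract a + to_fract b \<in> base_dom" for a b :: 'a
    by (metis rangeI to_fract_add)
  moreover have "to_fract a * to_fract b \<in> base_dom" for a b :: 'a
    by (metis rangeI to_fract_mult)
  ultimately show ?thesis
    unfolding fract_module.subspace_def by blast
qed

lemma one_in_base_dom: "1 \<in> base_dom"
  by (metis rangeI to_fract_1)

lemma base_dom_in_Fbar: "(base_dom :: 'a::idom fract set) \<in> Fbar"
proof -
  have "(base_dom :: 'a fract set) \<noteq> {0}"
    by (metis one_in_base_dom singletonD zero_neq_one)
  then show ?thesis
    using dsubmodule_base_dom by (simp add: Fbar_def)
qed

lemma mod_colon_iff: "z \<in> mod_colon E F \<longleftrightarrow> (\<forall>y\<in>F. z * y \<in> E)"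
  unfolding mod_colon_def by blast

lemma dsubmodule_mod_colon:
  assumes "dsubmodule E"
  shows "dsubmodule (mod_colon E F)"
proof -
  have "mod_colon E F = (\<Inter>y\<in>F. {z. y * z \<in> E})"
    by (auto simp: mod_colon_iff mult.commute)
  then show ?thesis
    using dsubmodule_mult_preimage[OF assms] by (auto intro!: fract_module.subspace_Inter)
qed

text \<open>A common denominator of \<open>I\<close> is a nonzero element of the inverse of \<open>I\<close>; without one,
  the inverse could be zero, where a semistar operation has no prescribed value.\<close>

lemma fractional_ideal_inverse_in_Fbar:
  assumes "fractional_ideal I"
  shows "mod_colon base_dom I \<in> Fbar"
proof -
  obtain d where "d \<noteq> 0" and "\<forall>x\<in>I. to_fract d * x \<in> base_dom"
    using assms unfolding fractional_ideal_def by blast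
  then have "to_fract d \<in> mod_colon base_dom I" and "to_fract d \<noteq> 0"
    by (auto simp: mod_colon_iff)
  then show ?thesis
    using dsubmodule_mod_colon[OF dsubmodule_base_dom] unfolding Fbar_def by blast
qed

lemma mod_prod_memI: "x \<in> E \<Longrightarrow> y \<in> F \<Longrightarrow> x * y \<in> mod_prod E F"
  unfolding mod_prod_def by (rule fract_module.span_base) blast

lemma mod_prod_subset:
  assumes "dsubmodule G" and "\<And>x y. x \<in> E \<Longrightarrow> y \<in> F \<Longrightarrow> x * y \<in> G"
  shows "mod_prod E F \<subseteq> G"
  unfolding mod_prod_def by (rule fract_module.span_minimal) (use assms in auto)

lemma Fbar_nonzero_elem:
  assumes "E \<in> Fbar"
  obtains x where "x \<in> E" "x \<noteq> 0"
proof -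
  have "0 \<in> E" and "E \<noteq> {0}"
    using assms fract_module.subspace_0 by (auto simp: Fbar_def)
  then show thesis
    using that by auto
qed

lemma mod_prod_in_Fbar:
  assumes "E \<in> Fbar" and "F \<in> Fbar"
  shows "mod_prod E F \<in> Fbar"
proof -
  obtain x y where "x \<in> E" "x \<noteq> 0" "y \<in> F" "y \<noteq> 0"
    using assms Fbar_nonzero_elem by metis
  then have "x * y \<in> mod_prod E F" "x * y \<noteq> 0"
    using mod_prod_memI by auto
  then show ?thesis
    unfolding Fbar_def mod_prod_def using fract_module.subspace_span by blast
qed

context
  fixes star :: "'a::idom fract set \<Rightarrow> 'a fract set"
  assumes star: "semistar_operation star"
begin

lemma semistar_in_Fbar: "E \<in> Fbar \<Longrightarrow> star E \<in> Fbar"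
  using star unfolding semistar_operation_def by (elim conjE) (rule funcset_mem)

lemma semistar_dsubmodule: "E \<in> Fbar \<Longrightarrow> dsubmodule (star E)"
  using semistar_in_Fbar[of E] by (simp add: Fbar_def)

lemma semistar_extensive: "E \<in> Fbar \<Longrightarrow> E \<subseteq> star E"
  using star unfolding semistar_operation_def by simp

lemma semistar_idem: "E \<in> Fbar \<Longrightarrow> star (star E) = star E"
  using star unfolding semistar_operation_def by simp

lemma semistar_mono: "E \<in> Fbar \<Longrightarrow> F \<in> Fbar \<Longrightarrow> E \<subseteq> F \<Longrightarrow> star E \<subseteq> star F"
  using star unfolding semistar_operation_def by simp

lemma semistar_least:
  assumes "E \<in> Fbar" and "F \<in> Fbar" and "E \<subseteq> star F"
  shows "star E \<subseteq> star F"
  using semistar_mono[OF assms(1) semistar_in_Fbar[OF assms(2)] assms(3)]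
    semistar_idem[OF assms(2)] by simp

text \<open>For \<open>x \<noteq> 0\<close> this is \<open>x E\<^sup>\<star> = (x E)\<^sup>\<star> \<subseteq> F\<^sup>\<star>\<close>. For \<open>x = 0\<close> the module \<open>x E\<close> is zero and has no
  closure, but the claim is trivial.\<close>

lemma semistar_mult_closed:
  assumes E: "E \<in> Fbar" and F: "F \<in> Fbar"
    and sub: "\<And>y. y \<in> E \<Longrightarrow> x * y \<in> star F" and y: "y \<in> star E"
  shows "x * y \<in> star F"
proof (cases "x = 0")
  case True
  then show ?thesis
    using fract_module.subspace_0[OF semistar_dsubmodule[OF F]] by simp
next
  case False
  obtain e where "e \<in> E" "e \<noteq> 0"
    using E Fbar_nonzero_elem by blast
  then have "x * e \<in> (\<lambda>y. x * y) ` E" and "x * e \<noteq> 0"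
    using False by auto
  moreover have "dsubmodule ((\<lambda>y. x * y) ` E)"
    using E dsubmodule_mult_image unfolding Fbar_def by blast
  ultimately have xE: "(\<lambda>y. x * y) ` E \<in> Fbar"
    unfolding Fbar_def by blast
  have "x * y \<in> (\<lambda>y. x * y) ` star E"
    using y by blast
  also have "\<dots> = star ((\<lambda>y. x * y) ` E)"
    using star False E unfolding semistar_operation_def by simp
  also have "\<dots> \<subseteq> star F"
    by (rule semistar_least[OF xE F]) (use sub in auto)
  finally show ?thesis .
qed

lemma mod_prod_semistar_subset:
  assumes "E \<in> Fbar" and "F \<in> Fbar"
  shows "mod_prod E (star F) \<subseteq> star (mod_prod E F)"
proof (rule mod_prod_subset)
  have EF: "mod_prod E F \<in> Fbar"
    using assms by (rule mod_prod_in_Fbar)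
  show "dsubmodule (star (mod_prod E F))"
    using EF by (rule semistar_dsubmodule)
  show "x * y \<in> star (mod_prod E F)" if "x \<in> E" "y \<in> star F" for x y
    using semistar_mult_closed[OF assms(2) EF _ that(2)] semistar_extensive[OF EF]
      mod_prod_memI[OF that(1)] by blast
qed

lemma semistar_mod_prod_semistar:
  assumes "E \<in> Fbar" and "F \<in> Fbar"
  shows "star (mod_prod E (star F)) = star (mod_prod E F)"
proof
  have EF: "mod_prod E F \<in> Fbar" and EF': "mod_prod E (star F) \<in> Fbar"
    using assms semistar_in_Fbar mod_prod_in_Fbar by auto
  show "star (mod_prod E (star F)) \<subseteq> star (mod_prod E F)"
    using semistar_least[OF EF' EF mod_prod_semistar_subset[OF assms]] .
  have "mod_prod E F \<subseteq> mod_prod E (star F)"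
    using EF' semistar_extensive[OF assms(2)]
    by (intro mod_prod_subset) (auto simp: Fbar_def intro: mod_prod_memI)
  then show "star (mod_prod E F) \<subseteq> star (mod_prod E (star F))"
    using semistar_mono[OF EF EF'] by blast
qed

lemma semistar_mod_colon_subset:
  assumes "E \<in> Fbar" and colon: "mod_colon E F \<in> Fbar"
  shows "star (mod_colon E F) \<subseteq> mod_colon (star E) F"
proof -
  have "y * z \<in> star E" if "y \<in> F" "z \<in> star (mod_colon E F)" for y z
  proof (rule semistar_mult_closed[OF colon assms(1) _ that(2)])
    show "y * w \<in> star E" if "w \<in> mod_colon E F" for w
      using that \<open>y \<in> F\<close> semistar_extensive[OF assms(1)]
      by (auto simp: mod_colon_iff mult.commute[of y])
  qed
  then show ?thesis
    by (metis mod_colon_iff mult.commute subsetI)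
qed

text \<open>If \<open>z I \<subseteq> D\<^sup>\<star>\<close>, then \<open>z I (D : I) \<subseteq> (D : I) D\<^sup>\<star> \<subseteq> (D : I)\<^sup>\<star>\<close>. This passes to the closure of
  \<open>I (D : I)\<close>, which contains \<open>1\<close>.\<close>

lemma mod_colon_subset_semistar_inverse:
  assumes I: "I \<in> Fbar" and A: "mod_colon base_dom I \<in> Fbar"
    and inv: "star (mod_prod I (mod_colon base_dom I)) = star base_dom"
  shows "mod_colon (star base_dom) I \<subseteq> star (mod_colon base_dom I)"
proof
  let ?A = "mod_colon base_dom I"
  fix z assume z: "z \<in> mod_colon (star base_dom) I"
  have sub: "dsubmodule (star ?A)"
    using A by (rule semistar_dsubmodule)
  have AD: "a * t \<in> star ?A" if a: "a \<in> ?A" and t: "t \<in> star base_dom" for a t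
  proof (rule semistar_mult_closed[OF base_dom_in_Fbar A _ t])
    show "a * d \<in> star ?A" if "d \<in> base_dom" for d
    proof -
      have "a \<in> star ?A"
        using a semistar_extensive[OF A] by blast
      then show ?thesis
        using that fract_module.subspace_scale[OF sub] by (auto simp: mult.commute)
    qed
  qed
  have "mod_prod I ?A \<subseteq> {p. z * p \<in> star ?A}"
  proof (rule mod_prod_subset)
    show "dsubmodule {p. z * p \<in> star ?A}"
      using sub by (rule dsubmodule_mult_preimage)
    show "i * a \<in> {p. z * p \<in> star ?A}" if "i \<in> I" "a \<in> ?A" for i a
    proof -
      have "a * (z * i) \<in> star ?A"
        using AD[OF that(2)] z that(1) by (simp add: mod_colon_iff)
      then show ?thesis
        by (simp add: ac_simps)
    qed
  qed
  moreover have "1 \<in> star (mod_prod I ?A)"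
    using inv semistar_extensive[OF base_dom_in_Fbar] one_in_base_dom by blast
  ultimately have "z * 1 \<in> star ?A"
    using semistar_mult_closed[OF mod_prod_in_Fbar[OF I A] A] by blast
  then show "z \<in> star ?A"
    by simp
qed

end

theorem proposition2p16:
  fixes star :: "'a::idom fract set \<Rightarrow> 'a fract set" and I :: "'a fract set"
  assumes "semistar_operation star"
    and "fractional_ideal I" and "I \<noteq> {0}"
    and "quasi_star_invertible star I"
  shows "star_invertible star I \<longleftrightarrow>
    star (mod_colon base_dom I) = mod_colon (star base_dom) I"
proof -
  have I: "I \<in> Fbar"
    and quasi: "star (mod_prod I (mod_colon (star base_dom) I)) = star base_dom"
    using assms(4) unfolding quasi_star_invertible_def by auto
  have A: "mod_colon base_dom I \<in> Fbar"
    using assms(2) by (rule fractional_ideal_inverse_in_Fbar)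
  show ?thesis
  proof
    assume "star_invertible star I"
    then have "star (mod_prod I (mod_colon base_dom I)) = star base_dom"
      unfolding star_invertible_def by blast
    then show "star (mod_colon base_dom I) = mod_colon (star base_dom) I"
      using semistar_mod_colon_subset[OF assms(1) base_dom_in_Fbar A]
        mod_colon_subset_semistar_inverse[OF assms(1) I A] by blast
  next
    assume "star (mod_colon base_dom I) = mod_colon (star base_dom) I"
    then have "star (mod_prod I (mod_colon base_dom I)) = star base_dom"
      using semistar_mod_prod_semistar[OF assms(1) I A] quasi by simp
    then show "star_invertible star I"
      using assms(2,3) unfolding star_invertible_def by blast
  qed
qed

end
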